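(* The spectral region of the $4$-cycle stochastic matrices, i.e. the set of all $\lambda\in\mathbb{C}$ such that $\lambda\in\sigma(A(\alpha_1,\alpha_2,\alpha_3,\alpha_4))$ for some $\alpha_1,\alpha_2,\alpha_3,\alpha_4\in[0,1)$, is exactly $$\{a+ib:\ a,b\in\mathbb{R},\ 0\le a<1,\ a+|b|\le 1,\ G(a,b)\ge 0\}\ \cup\ [-1,1].$$
   Context: For $\alpha_1,\alpha_2,\alpha_3,\alpha_4\in[0,1)$, the $4$-cycle stochastic matrix is $$A(\alpha_1,\alpha_2,\alpha_3,\alpha_4)=\begin{pmatrix}\alpha_1&1-\alpha_1&0&0\\0&\alpha_2&1-\alpha_2&0\\0&0&\alpha_3&1-\alpha_3\\1-\alpha_4&0&0&\alpha_4\end{pmatrix}.$$ $\sigma(A)$ denotes the spectrum (set of complex eigenvalues) of $A$. For real $a,b$, $G(a,b):=(b^2+a^2+a)^2+2a^2-b^2$. The interval $[-1,1]$ is regarded as a subset of $\mathbb{R}\subset\mathbb{C}$. *)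

theory Defs
  imports "Jordan_Normal_Form.Spectral_Radius"
begin

definition cycle4_mat :: "real \<Rightarrow> real \<Rightarrow> real \<Rightarrow> real \<Rightarrow> real mat" where
  "cycle4_mat \<alpha>\<^sub>1 \<alpha>\<^sub>2 \<alpha>\<^sub>3 \<alpha>\<^sub>4 = mat_of_rows_list 4
     [[\<alpha>\<^sub>1, 1 - \<alpha>\<^sub>1, 0, 0],
      [0, \<alpha>\<^sub>2, 1 - \<alpha>\<^sub>2, 0],
      [0, 0, \<alpha>\<^sub>3, 1 - \<alpha>\<^sub>3],
      [1 - \<alpha>\<^sub>4, 0, 0, \<alpha>\<^sub>4]]"

text \<open>The spectrum of a real matrix is taken over the complex numbers, so the entries are
  embedded first.\<close>

definition complex_spectrum :: "real mat \<Rightarrow> complex set" where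
  "complex_spectrum A = spectrum (map_mat complex_of_real A)"

definition cycle4_spectral_region :: "complex set" where
  "cycle4_spectral_region =
     {z. \<exists>\<alpha>\<^sub>1\<in>{0..<1}. \<exists>\<alpha>\<^sub>2\<in>{0..<1}. \<exists>\<alpha>\<^sub>3\<in>{0..<1}. \<exists>\<alpha>\<^sub>4\<in>{0..<1}.
          z \<in> complex_spectrum (cycle4_mat \<alpha>\<^sub>1 \<alpha>\<^sub>2 \<alpha>\<^sub>3 \<alpha>\<^sub>4)}"

definition G :: "real \<Rightarrow> real \<Rightarrow> real" where
  "G a b = (b\<^sup>2 + a\<^sup>2 + a)\<^sup>2 + 2 * a\<^sup>2 - b\<^sup>2"

end

theory Submission
  imports Defs
begin

text \<open>
  A number \<open>z\<close> is an eigenvalue of the cycle matrix iff the four factors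
  \<open>(z - \<alpha>\<^sub>i) / (1 - \<alpha>\<^sub>i)\<close> multiply to \<open>1\<close>. With \<open>t = 1 / (1 - \<alpha>)\<close> such a factor is
  \<open>1 + t * (z - 1)\<close>, so the question is geometric: on the line from \<open>1\<close> through \<open>z\<close>, look at the
  ray that starts in \<open>z\<close> and leads away from \<open>1\<close>; for which \<open>z\<close> are there four points on this ray
  with product \<open>1\<close> (lemma \<open>cycle4_spectral_region_iff\<close>)? Conjugation reduces nonreal \<open>z\<close> to
  the upper half plane. For real \<open>z\<close> in \<open>[-1, 1)\<close> the ray contains \<open>-1\<close>, which is taken four times.

  Necessity (\<open>upper_half_plane_necessary\<close>). If \<open>z\<close> lies in the upper half plane, so does the
  ray; the arguments of the four points lie in \<open>(0, \<pi>)\<close>, hence they sum to exactly \<open>2\<pi>\<close>, and each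
  of them is at least \<open>\<theta> = arg z\<close>. This already gives \<open>\<theta> \<le> \<pi> / 2\<close>. In polar coordinates the line is
  \<open>r * sin (arg + \<phi>) = sin \<phi>\<close>, where \<open>\<phi>\<close> is the angle that it makes with the real axis at \<open>1\<close>.
  The product of the moduli being \<open>1\<close>, the product of the four sines is \<open>sin \<phi> ^ 4\<close>.
  Now \<open>sin\<close> is logarithmically concave on \<open>[0, \<pi>]\<close>, so that for a given sum of angles the product of
  sines is largest when all angles are equal and smallest when three of them take their least
  value. The upper bound (\<open>prod_four_sin_le_sin_mean\<close>) says that the line meets the imaginary axis
  at height at most \<open>1\<close>, which is \<open>a + b \<le> 1\<close>. The lower bound (\<open>prod_four_sin_ge_extreme\<close>),
  multiplied out, is \<open>G a b \<ge> 0\<close> up to the positive factor \<open>\<bar>z - 1\<bar>\<^sup>2\<close> (\<open>G_factor\<close>). It needs the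
  fourth angle to be at most \<open>\<pi>\<close>; otherwise \<open>G a b < 0\<close> would force \<open>\<theta> > \<pi> / 3\<close>, whence the fourth sine
  is not positive and the bound is trivial.

  Sufficiency (\<open>upper_half_plane_sufficient\<close>). For every nonzero point \<open>m\<close> of the curve \<open>G x y = 0\<close>, the point
  \<open>1 / m ^ 3\<close> lies on the line through \<open>1\<close> and \<open>m\<close>. Moving \<open>m\<close> from \<open>z\<close> along the ray to the
  imaginary axis takes \<open>G\<close> from a nonnegative to a nonpositive value, so some \<open>m\<close> on the way
  satisfies \<open>G = 0\<close>; the four points are then \<open>m, m, m, 1 / m ^ 3\<close>. That the last of them lies on the ray, even beyond
  \<open>m\<close>, follows from \<open>G = 0\<close> and \<open>Re m \<ge> 0\<close>.
\<close>

section \<open>Eigenvalues as products of four points on a ray\<close>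

text \<open>
  The eigenvector equations express each coordinate as a factor times the previous one, in
  cyclic order. Going once around the cycle, the first coordinate must be multiplied by \<open>1\<close>;
  conversely, any nonzero first coordinate then extends to an eigenvector.
\<close>

lemma cycle4_eigenvalue_iff:
  assumes "p \<noteq> 1" "q \<noteq> 1" "r \<noteq> 1" "s \<noteq> 1"
  shows "z \<in> complex_spectrum (cycle4_mat p q r s) \<longleftrightarrow>
    (z - of_real p) / (1 - of_real p) * ((z - of_real q) / (1 - of_real q)) *
    ((z - of_real r) / (1 - of_real r)) * ((z - of_real s) / (1 - of_real s)) = 1"
    (is "_ \<longleftrightarrow> ?P * ?Q * ?R * ?S = 1")
proof -
  define M where "M = map_mat complex_of_real (cycle4_mat p q r s)"
  have dim: "dim_row M = 4" "dim_col M = 4"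
    by (simp_all add: M_def cycle4_mat_def mat_of_rows_list_def)
  have nz: "1 - complex_of_real p \<noteq> 0" "1 - complex_of_real q \<noteq> 0"
    "1 - complex_of_real r \<noteq> 0" "1 - complex_of_real s \<noteq> 0"
    using assms by (metis eq_iff_diff_eq_0 of_real_eq_1_iff)+
  have less4: "(\<forall>i<4. Q i) \<longleftrightarrow> Q 0 \<and> Q 1 \<and> Q 2 \<and> Q (3::nat)" for Q
    by (auto simp: eval_nat_numeral less_Suc_eq)
  have sum4: "sum f {0..<4} = f 0 + f 1 + f 2 + f (3::nat)" for f :: "nat \<Rightarrow> complex"
    by (simp add: eval_nat_numeral)
  have eigen: "eigenvector M v z \<longleftrightarrow> dim_vec v = 4 \<and> v $ 0 \<noteq> 0 \<and> ?P * ?Q * ?R * ?S = 1 \<and>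
      v $ 1 = ?P * v $ 0 \<and> v $ 2 = ?Q * v $ 1 \<and> v $ 3 = ?R * v $ 2" for v
  proof (cases "dim_vec v = 4")
    case True
    have row: "a * x + (1 - a) * y = z * x \<longleftrightarrow> y = (z - a) / (1 - a) * x"
      if "1 - a \<noteq> 0" for a x y :: complex
    proof -
      have "a * x + (1 - a) * y = z * x \<longleftrightarrow> (1 - a) * y = (z - a) * x"
        by (auto simp: algebra_simps)
      also have "\<dots> \<longleftrightarrow> y = (z - a) / (1 - a) * x"
        using that by (auto simp: nonzero_eq_divide_eq mult.commute)
      finally show ?thesis .
    qed
    have "M *\<^sub>v v = z \<cdot>\<^sub>v v \<longleftrightarrow> (\<forall>i<4. (M *\<^sub>v v) $ i = z * v $ i)"
      using True dim by (auto simp: vec_eq_iff)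
    also have "\<dots> \<longleftrightarrow> of_real p * v $ 0 + (1 - of_real p) * v $ 1 = z * v $ 0 \<and>
        of_real q * v $ 1 + (1 - of_real q) * v $ 2 = z * v $ 1 \<and>
        of_real r * v $ 2 + (1 - of_real r) * v $ 3 = z * v $ 2 \<and>
        of_real s * v $ 3 + (1 - of_real s) * v $ 0 = z * v $ 3"
      unfolding less4 using True dim
      by (simp add: M_def cycle4_mat_def mat_of_rows_list_def scalar_prod_def sum4 add.commute)
    also have "\<dots> \<longleftrightarrow> v $ 1 = ?P * v $ 0 \<and> v $ 2 = ?Q * v $ 1 \<and>
        v $ 3 = ?R * v $ 2 \<and> v $ 0 = ?S * v $ 3"
      using row nz by presburger
    finally have eqs: "M *\<^sub>v v = z \<cdot>\<^sub>v v \<longleftrightarrow> v $ 1 = ?P * v $ 0 \<and> v $ 2 = ?Q * v $ 1 \<and>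
        v $ 3 = ?R * v $ 2 \<and> v $ 0 = ?S * v $ 3" .
    have zero: "v = 0\<^sub>v 4 \<longleftrightarrow> v $ 0 = 0 \<and> v $ 1 = 0 \<and> v $ 2 = 0 \<and> v $ 3 = 0"
    proof -
      have "v = 0\<^sub>v 4 \<longleftrightarrow> (\<forall>i<4. v $ i = 0)"
        unfolding vec_eq_iff using True by simp
      then show ?thesis by (simp only: less4)
    qed
    have cyc: "v1 = P * v0 \<and> v2 = Q * v1 \<and> v3 = R * v2 \<and> v0 = S * v3 \<and>
        \<not> (v0 = 0 \<and> v1 = 0 \<and> v2 = 0 \<and> v3 = 0) \<longleftrightarrow>
        v0 \<noteq> 0 \<and> P * Q * R * S = 1 \<and> v1 = P * v0 \<and> v2 = Q * v1 \<and> v3 = R * v2"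
      for v0 v1 v2 v3 P Q R S :: complex
    proof -
      have "S * (R * (Q * (P * v0))) = v0 * (P * Q * R * S)" by (simp add: mult_ac)
      then have "v0 = S * (R * (Q * (P * v0))) \<longleftrightarrow> v0 = 0 \<or> P * Q * R * S = 1"
        by (simp only: mult_cancel_left1)
      then show ?thesis by auto
    qed
    have "v \<in> carrier_vec 4" using True by (rule carrier_vecI)
    then show ?thesis
      unfolding eigenvector_def dim eqs zero
      using True cyc[of "v $ 1" ?P "v $ 0" "v $ 2" ?Q "v $ 3" ?R ?S] by blast
  next
    case False
    then have "v \<notin> carrier_vec 4" by (metis carrier_vecD)
    then show ?thesis unfolding eigenvector_def dim using False by blast
  qed
  have "\<exists>v. dim_vec v = 4 \<and> v $ 0 \<noteq> 0 \<and> v $ 1 = P * v $ 0 \<and> v $ 2 = Q * v $ 1 \<and> v $ 3 = R * v $ 2"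
    for P Q R :: complex
    by (rule exI[of _ "vec 4 (\<lambda>i. [1, P, Q * P, R * (Q * P)] ! i)"]) simp
  then show ?thesis
    unfolding complex_spectrum_def spectrum_def eigenvalue_def M_def[symmetric] mem_Collect_eq eigen
    by metis
qed

lemma cycle4_spectral_region_iff:
  "z \<in> cycle4_spectral_region \<longleftrightarrow>
    (\<exists>t\<^sub>1\<ge>1. \<exists>t\<^sub>2\<ge>1. \<exists>t\<^sub>3\<ge>1. \<exists>t\<^sub>4\<ge>1. (1 + of_real t\<^sub>1 * (z - 1)) * (1 + of_real t\<^sub>2 * (z - 1)) *
       (1 + of_real t\<^sub>3 * (z - 1)) * (1 + of_real t\<^sub>4 * (z - 1)) = 1)"
  (is "_ \<longleftrightarrow> ?rhs")
proof -
  let ?m = "\<lambda>p. (z - of_real p) / (1 - of_real p)"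
  let ?M = "?m ` {0..<1}"
  have reparam: "?M = (\<lambda>t. 1 + of_real t * (z - 1)) ` {1..}"
  proof -
    have m: "?m p = 1 + of_real (1 / (1 - p)) * (z - 1)" if "p \<in> {0..<1}" for p :: real
    proof -
      have "1 - complex_of_real p \<noteq> 0"
        using that by (metis atLeastLessThan_iff eq_iff_diff_eq_0 less_irrefl of_real_eq_1_iff)
      then show ?thesis by (simp add: field_simps)
    qed
    have bij: "(\<lambda>p. 1 / (1 - p)) ` {0..<1} = {1::real..}"
    proof (intro subset_antisym subsetI)
      fix t :: real assume "t \<in> {1..}"
      then have "t = 1 / (1 - (1 - 1 / t))" "1 - 1 / t \<in> {0..<1}" by simp_all
      then show "t \<in> (\<lambda>p. 1 / (1 - p)) ` {0..<1}" by (rule image_eqI)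
    qed auto
    show ?thesis unfolding bij[symmetric] image_image by (intro image_cong refl m)
  qed
  have "z \<in> cycle4_spectral_region \<longleftrightarrow>
    (\<exists>p\<in>{0..<1}. \<exists>q\<in>{0..<1}. \<exists>r\<in>{0..<1}. \<exists>s\<in>{0..<1}. ?m p * ?m q * ?m r * ?m s = 1)"
    unfolding cycle4_spectral_region_def mem_Collect_eq
    by (intro bex_cong refl cycle4_eigenvalue_iff) auto
  also have "\<dots> \<longleftrightarrow> (\<exists>k\<in>?M. \<exists>l\<in>?M. \<exists>m\<in>?M. \<exists>n\<in>?M. k * l * m * n = 1)"
    by blast
  also have "\<dots> \<longleftrightarrow> ?rhs"
    unfolding reparam by (simp add: Bex_def)
  finally show ?thesis .
qed

text \<open>
  If \<open>z\<close> lies outside the closed unit disc, then so does the whole ray, since the disc is convex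
  and contains the point \<open>1\<close>. This is the spectral bound for stochastic matrices.
\<close>

lemma norm_le_1_of_prod_eq_1:
  fixes z :: complex
  assumes t: "t\<^sub>1 \<ge> 1" "t\<^sub>2 \<ge> 1" "t\<^sub>3 \<ge> 1" "t\<^sub>4 \<ge> 1"
    and prod: "(1 + of_real t\<^sub>1 * (z - 1)) * (1 + of_real t\<^sub>2 * (z - 1)) *
       (1 + of_real t\<^sub>3 * (z - 1)) * (1 + of_real t\<^sub>4 * (z - 1)) = 1"
  shows "norm z \<le> 1"
proof (rule ccontr)
  assume "\<not> norm z \<le> 1"
  then have big: "norm z > 1" by simp
  have gt: "norm (1 + of_real t * (z - 1)) > 1" if "t \<ge> 1" for t :: real
  proof -
    have "t * norm z = norm ((1 + of_real t * (z - 1)) + of_real (t - 1))"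
      using that by (simp add: algebra_simps norm_mult)
    also have "\<dots> \<le> norm (1 + of_real t * (z - 1)) + (t - 1)"
      using that norm_triangle_ineq[of "1 + of_real t * (z - 1)" "of_real (t - 1)"]
      by (simp del: of_real_diff)
    finally have le: "t * norm z \<le> norm (1 + of_real t * (z - 1)) + (t - 1)" .
    have "t * norm z > t" using big that by simp
    then show ?thesis using le by linarith
  qed
  have "norm (1 + of_real t\<^sub>1 * (z - 1)) * norm (1 + of_real t\<^sub>2 * (z - 1)) *
      norm (1 + of_real t\<^sub>3 * (z - 1)) * norm (1 + of_real t\<^sub>4 * (z - 1)) > 1"
    by (intro less_1_mult gt t)
  then show False using prod by (simp flip: norm_mult)
qed

section \<open>Products of four sines with a given sum of angles\<close>

lemma sin_mult_sin_le_sin_mean: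
  fixes x y :: real
  shows "sin x * sin y \<le> (sin ((x + y) / 2))\<^sup>2"
proof -
  define u v where "u = (x + y) / 2" and "v = (x - y) / 2"
  have xy: "x = u + v" "y = u - v" by (simp_all add: u_def v_def field_simps)
  have "sin x * sin y = (sin u)\<^sup>2 * (cos v)\<^sup>2 - (cos u)\<^sup>2 * (sin v)\<^sup>2"
    unfolding xy sin_add sin_diff by Groebner_Basis.algebra
  also have "\<dots> = (sin u)\<^sup>2 - (sin v)\<^sup>2"
    by (simp add: cos_squared_eq algebra_simps)
  finally show ?thesis by (simp add: u_def)
qed

lemma prod_four_sin_le_sin_mean:
  fixes A B C D :: real
  assumes "A \<in> {0..pi}" "B \<in> {0..pi}" "C \<in> {0..pi}" "D \<in> {0..pi}"
  shows "sin A * sin B * sin C * sin D \<le> sin ((A + B + C + D) / 4) ^ 4"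
proof -
  let ?u = "sin ((A + B) / 2)" and ?v = "sin ((C + D) / 2)"
  have nonneg: "0 \<le> sin A * sin B" "0 \<le> sin C * sin D" "0 \<le> ?u" "0 \<le> ?v"
    using assms by (auto intro!: mult_nonneg_nonneg sin_ge_zero)
  have "(sin A * sin B) * (sin C * sin D) \<le> ?u\<^sup>2 * ?v\<^sup>2"
    using nonneg by (intro mult_mono sin_mult_sin_le_sin_mean) auto
  also have "\<dots> = (?u * ?v)\<^sup>2" by (simp add: power_mult_distrib)
  also have "\<dots> \<le> ((sin (((A + B) / 2 + (C + D) / 2) / 2))\<^sup>2)\<^sup>2"
    using nonneg by (intro power_mono sin_mult_sin_le_sin_mean) auto
  also have "((A + B) / 2 + (C + D) / 2) / 2 = (A + B + C + D) / 4"
    by (simp add: add_divide_distrib)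
  finally show ?thesis by (simp add: mult.assoc)
qed

text \<open>
  This identity measures the loss when two angles are spread apart, with constant sum, until one
  of them reaches \<open>x\<close>.
\<close>

lemma sin_mult_sin_minus_spread:
  fixes A B x :: real
  shows "sin A * sin B - sin x * sin (A + B - x) = sin (A - x) * sin (B - x)"
proof -
  define u v where "u = A - x" and "v = B - x"
  have *: "A = x + u" "B = x + v" "A + B - x = x + (u + v)" by (simp_all add: u_def v_def)
  have "sin (x + u) * sin (x + v) - sin x * sin (x + (u + v)) =
      ((sin x)\<^sup>2 + (cos x)\<^sup>2) * (sin u * sin v)"
    unfolding sin_add cos_add by Groebner_Basis.algebra
  then show ?thesis unfolding * by simp
qed

text \<open>
  Three spreading steps push \<open>A\<close>, \<open>B\<close>, \<open>C\<close> down to the common lower bound \<open>x\<close>, one after the other,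
  and collect the excess in the remaining angle. The last hypothesis bounds this angle by \<open>\<pi>\<close>
  throughout, because it only grows, which makes every step decrease the product.
\<close>

lemma prod_four_sin_ge_extreme:
  fixes A B C D x :: real
  assumes "0 \<le> x" "x \<le> A" "x \<le> B" "x \<le> C" "x \<le> D" and le: "A + B + C + D - 3 * x \<le> pi"
  shows "sin A * sin B * sin C * sin D \<ge> sin x ^ 3 * sin (A + B + C + D - 3 * x)"
proof -
  have spread: "sin a * sin b \<ge> sin x * sin (a + b - x)"
    if "x \<le> a" "x \<le> b" "a + b - x \<le> pi" for a b
    using sin_mult_sin_minus_spread[of a b x] that \<open>0 \<le> x\<close>
      sin_ge_zero[of "a - x"] sin_ge_zero[of "b - x"]
    by (smt (verit) mult_nonneg_nonneg)
  have nonneg: "0 \<le> sin x" "0 \<le> sin C" "0 \<le> sin D"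
    using assms by (auto intro!: sin_ge_zero)
  have 3: "sin (A + B + C - 2 * x) * sin D \<ge> sin x * sin (A + B + C + D - 3 * x)"
    using spread[of "A + B + C - 2 * x" D] assms by (simp add: algebra_simps)
  have 2: "sin (A + B - x) * sin C \<ge> sin x * sin (A + B + C - 2 * x)"
    using spread[of "A + B - x" C] assms by (simp add: algebra_simps)
  have 1: "sin A * sin B \<ge> sin x * sin (A + B - x)"
    using spread[of A B] assms by simp
  have "sin x ^ 3 * sin (A + B + C + D - 3 * x)
      = (sin x)\<^sup>2 * (sin x * sin (A + B + C + D - 3 * x))"
    by (simp add: power2_eq_square power3_eq_cube)
  also have "\<dots> \<le> (sin x)\<^sup>2 * (sin (A + B + C - 2 * x) * sin D)"
    by (intro mult_left_mono 3) simp
  also have "\<dots> = sin x * sin D * (sin x * sin (A + B + C - 2 * x))"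
    by (simp add: power2_eq_square)
  also have "\<dots> \<le> sin x * sin D * (sin (A + B - x) * sin C)"
    using nonneg by (intro mult_left_mono 2) simp
  also have "\<dots> = sin C * sin D * (sin x * sin (A + B - x))" by simp
  also have "\<dots> \<le> sin C * sin D * (sin A * sin B)"
    using nonneg by (intro mult_left_mono 1) simp
  finally show ?thesis by (simp add: mult_ac)
qed

section \<open>The upper half plane\<close>

text \<open>
  With \<open>z = a + i b\<close>, the right-hand side times \<open>b\<close> is \<open>b * \<bar>z\<bar> ^ 6 - Im (z ^ 3 * (z - 1))\<close>, which
  compares the modulus of \<open>1 / z ^ 3\<close> with that of the point of the line in the same direction. It
  vanishes trivially at \<open>z = 1\<close>, whence the factor \<open>\<bar>z - 1\<bar>\<^sup>2\<close>.
\<close>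

lemma G_factor:
  "((1 - a)\<^sup>2 + b\<^sup>2) * G a b =
    (a\<^sup>2 + b\<^sup>2) ^ 3 - (a ^ 3 - 3 * a * b\<^sup>2) + (1 - a) * (3 * a\<^sup>2 - b\<^sup>2)"
  unfolding G_def by Groebner_Basis.algebra

text \<open>
  In the proof, \<open>m t\<close> is a point of the ray, with polar coordinates \<open>r t\<close> and \<open>\<theta> t\<close>; the parameter
  \<open>1\<close> belongs to \<open>z\<close> itself. The pair \<open>\<rho>\<close>, \<open>\<phi>\<close> gives length and slope of the segment from \<open>1\<close> to \<open>z\<close>.
\<close>

lemma upper_half_plane_necessary:
  fixes z :: complex
  assumes Im_pos: "Im z > 0"
    and t: "t\<^sub>1 \<ge> 1" "t\<^sub>2 \<ge> 1" "t\<^sub>3 \<ge> 1" "t\<^sub>4 \<ge> 1"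
    and prod: "(1 + of_real t\<^sub>1 * (z - 1)) * (1 + of_real t\<^sub>2 * (z - 1)) *
       (1 + of_real t\<^sub>3 * (z - 1)) * (1 + of_real t\<^sub>4 * (z - 1)) = 1"
  shows "0 \<le> Re z \<and> Re z < 1 \<and> Re z + Im z \<le> 1 \<and> G (Re z) (Im z) \<ge> 0"
proof -
  define a b where "a = Re z" and "b = Im z"
  have z: "z = Complex a b" by (simp add: a_def b_def)
  have b: "b > 0" using Im_pos by (simp add: b_def)
  have "norm z \<le> 1" using norm_le_1_of_prod_eq_1[OF t prod] .
  have "a < 1"
  proof (rule ccontr)
    assume "\<not> a < 1"
    then have "1 \<le> a\<^sup>2" by simp
    moreover have "a\<^sup>2 + b\<^sup>2 \<le> 1"
      using \<open>norm z \<le> 1\<close> by (simp add: z complex_norm)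
    ultimately have "b\<^sup>2 \<le> 0" by linarith
    then show False using b by simp
  qed
  define \<rho> \<phi> where "\<rho> = norm (Complex (1 - a) b)" and "\<phi> = Arg (Complex (1 - a) b)"
  have c_polar: "1 - a = \<rho> * cos \<phi>" "b = \<rho> * sin \<phi>"
    using rcis_cmod_Arg[of "Complex (1 - a) b"]
    by (simp_all add: \<rho>_def \<phi>_def rcis_def complex_eq_iff)
  have "\<rho> > 0" using b by (simp add: \<rho>_def complex_eq_iff)
  have s\<phi>: "sin \<phi> > 0" using c_polar(2) b \<open>\<rho> > 0\<close> by (simp add: zero_less_mult_iff)
  have c\<phi>: "cos \<phi> > 0" using c_polar(1) \<open>a < 1\<close> \<open>\<rho> > 0\<close> by (smt (verit) mult_nonneg_nonpos)
  have Arg_upper: "0 < Arg w \<and> Arg w < pi" if "Im w > 0" for w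
  proof -
    have "norm w * sin (Arg w) = Im w"
      using rcis_cmod_Arg[of w] by (simp add: rcis_def complex_eq_iff)
    then have "sin (Arg w) > 0" using that by (metis norm_ge_zero mult_nonneg_nonpos not_le)
    then show ?thesis
      using Arg_bounded[of w] sin_ge_zero[of "- Arg w"]
      by (cases "Arg w = pi") (auto simp: not_less[symmetric])
  qed
  have \<phi>: "0 < \<phi>" "\<phi> < pi / 2"
  proof -
    have "0 < \<phi> \<and> \<phi> < pi" unfolding \<phi>_def using b by (intro Arg_upper) simp
    then show "0 < \<phi>" by simp
    show "\<phi> < pi / 2"
      using \<open>0 < \<phi> \<and> \<phi> < pi\<close> c\<phi> cos_monotone_0_pi_le[of "pi/2" \<phi>] by force
  qed
  define m where "m t = 1 + of_real t * (z - 1)" for t :: real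
  define r \<theta> where "r t = norm (m t)" and "\<theta> t = Arg (m t)" for t
  have m_Im: "Im (m t) = t * b" and m_Re: "Re (m t) = 1 - t * (1 - a)" for t
    by (simp_all add: m_def z algebra_simps)
  have polar: "Re (m t) = r t * cos (\<theta> t)" "Im (m t) = r t * sin (\<theta> t)" for t
    using rcis_cmod_Arg[of "m t"]
    by (simp_all add: r_def \<theta>_def rcis_def complex_eq_iff)
  have \<theta>: "0 < \<theta> t \<and> \<theta> t < pi" if "t \<ge> 1" for t
    unfolding \<theta>_def using that b by (intro Arg_upper) (simp add: m_Im)
  have r: "r t > 0" if "t \<ge> 1" for t
    using that b m_Im[of t] by (auto simp: r_def complex_eq_iff)
  \<comment> \<open>the equation of the line through \<open>1\<close> and \<open>z\<close> in polar coordinates\<close>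
  have line: "r t * sin (\<theta> t + \<phi>) = sin \<phi>" for t
  proof -
    have "\<rho> * (r t * sin (\<theta> t + \<phi>)) = Im (m t) * (1 - a) + Re (m t) * b"
      unfolding polar c_polar sin_add by (simp add: algebra_simps)
    also have "\<dots> = b" by (simp add: m_Im m_Re algebra_simps)
    also have "\<dots> = \<rho> * sin \<phi>" by (fact c_polar)
    finally show ?thesis using \<open>\<rho> > 0\<close> by simp
  qed
  have sin_pos: "sin (\<theta> t + \<phi>) > 0" if "t \<ge> 1" for t
    using line[of t] r[OF that] s\<phi> by (metis zero_less_mult_pos)
  have \<theta>\<phi>: "0 < \<theta> t + \<phi> \<and> \<theta> t + \<phi> < pi" if "t \<ge> 1" for t
  proof (rule ccontr)
    assume "\<not> ?thesis"
    then have "pi \<le> \<theta> t + \<phi>" using \<theta>[OF that] \<phi> by linarith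
    then have "sin (\<theta> t + \<phi>) \<le> 0" using \<theta>[OF that] \<phi> by (intro sin_le_zero) auto
    then show False using sin_pos[OF that] by simp
  qed
  \<comment> \<open>arguments increase along the ray: the sign of \<open>sin (\<theta> t - \<theta> 1)\<close> is that of \<open>Im (m t * cnj z)\<close>\<close>
  have mono: "\<theta> 1 \<le> \<theta> t" if "t \<ge> 1" for t
  proof -
    have "r t * r 1 * sin (\<theta> t - \<theta> 1) = Im (m t) * Re (m 1) - Re (m t) * Im (m 1)"
      unfolding polar sin_diff by (simp add: algebra_simps)
    also have "\<dots> = (t - 1) * b" unfolding m_Im m_Re by Groebner_Basis.algebra
    also have "\<dots> \<ge> 0" using that b by simp
    finally have "0 \<le> r t * r 1 * sin (\<theta> t - \<theta> 1)" .
    moreover have "0 < r t * r 1" using r[OF that] r[of 1] by simp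
    ultimately have "sin (\<theta> t - \<theta> 1) \<ge> 0" by (metis not_le zero_le_mult_iff)
    then show ?thesis
      using \<theta>[OF that] \<theta>[of 1] sin_gt_zero[of "\<theta> 1 - \<theta> t"] sin_minus[of "\<theta> 1 - \<theta> t"] by force
  qed
  have rcis: "m t = rcis (r t) (\<theta> t)" for t by (simp add: r_def \<theta>_def rcis_cmod_Arg)
  define R \<Theta> where "R = r t\<^sub>1 * r t\<^sub>2 * r t\<^sub>3 * r t\<^sub>4"
    and "\<Theta> = \<theta> t\<^sub>1 + \<theta> t\<^sub>2 + \<theta> t\<^sub>3 + \<theta> t\<^sub>4"
  have prod': "m t\<^sub>1 * m t\<^sub>2 * m t\<^sub>3 * m t\<^sub>4 = 1" using prod by (simp add: m_def)
  have R: "R = 1"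
    using arg_cong[OF prod', of norm] by (simp add: R_def r_def norm_mult)
  have "rcis R \<Theta> = 1" using prod' unfolding rcis rcis_mult R_def \<Theta>_def .
  then have "cos \<Theta> = 1" by (simp add: R rcis_def complex_eq_iff)
  then obtain n :: int where n: "\<Theta> = of_int n * 2 * pi" by (auto simp: cos_one_2pi_int)
  have "0 < \<Theta>" "\<Theta> < 4 * pi"
    using \<theta>[OF t(1)] \<theta>[OF t(2)] \<theta>[OF t(3)] \<theta>[OF t(4)] by (auto simp: \<Theta>_def)
  then have "0 < real_of_int n" "real_of_int n < 2"
    unfolding n by (simp_all add: zero_less_mult_iff)
  then have "n = 1" by linarith
  then have \<Theta>: "\<Theta> = 2 * pi" using n by simp
  have sines: "sin (\<theta> t\<^sub>1 + \<phi>) * sin (\<theta> t\<^sub>2 + \<phi>) * sin (\<theta> t\<^sub>3 + \<phi>) * sin (\<theta> t\<^sub>4 + \<phi>) = sin \<phi> ^ 4"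
  proof -
    have "sin \<phi> ^ 4 = (r t\<^sub>1 * sin (\<theta> t\<^sub>1 + \<phi>)) * (r t\<^sub>2 * sin (\<theta> t\<^sub>2 + \<phi>)) *
        (r t\<^sub>3 * sin (\<theta> t\<^sub>3 + \<phi>)) * (r t\<^sub>4 * sin (\<theta> t\<^sub>4 + \<phi>))"
      unfolding line by (simp add: eval_nat_numeral)
    also have "\<dots> = R * (sin (\<theta> t\<^sub>1 + \<phi>) * sin (\<theta> t\<^sub>2 + \<phi>) * sin (\<theta> t\<^sub>3 + \<phi>) * sin (\<theta> t\<^sub>4 + \<phi>))"
      by (simp add: R_def mult_ac)
    finally show ?thesis by (simp add: R)
  qed
  have "\<theta> 1 \<le> pi / 2"
    using mono[OF t(1)] mono[OF t(2)] mono[OF t(3)] mono[OF t(4)] \<Theta> by (simp add: \<Theta>_def)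
  have z_polar: "a = r 1 * cos (\<theta> 1)" "b = r 1 * sin (\<theta> 1)"
    using polar[of 1] by (simp_all add: m_Re m_Im)
  have "a \<ge> 0"
    using z_polar(1) r[of 1] \<theta>[of 1] \<open>\<theta> 1 \<le> pi / 2\<close> by (simp add: cos_ge_zero)
  have "a + b \<le> 1"
  proof -
    have "sin \<phi> ^ 4 \<le> sin ((\<theta> t\<^sub>1 + \<phi> + (\<theta> t\<^sub>2 + \<phi>) + (\<theta> t\<^sub>3 + \<phi>) + (\<theta> t\<^sub>4 + \<phi>)) / 4) ^ 4"
      unfolding sines[symmetric]
      using \<theta>\<phi>[OF t(1)] \<theta>\<phi>[OF t(2)] \<theta>\<phi>[OF t(3)] \<theta>\<phi>[OF t(4)]
      by (intro prod_four_sin_le_sin_mean) auto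
    also have "(\<theta> t\<^sub>1 + \<phi> + (\<theta> t\<^sub>2 + \<phi>) + (\<theta> t\<^sub>3 + \<phi>) + (\<theta> t\<^sub>4 + \<phi>)) / 4 = \<phi> + pi / 2"
      using \<Theta> by (simp add: \<Theta>_def field_simps)
    also have "sin (\<phi> + pi / 2) = cos \<phi>" by (simp add: sin_add)
    finally have "sin \<phi> \<le> cos \<phi>" using c\<phi> by (simp add: power_mono_iff s\<phi> less_imp_le)
    then have "\<rho> * sin \<phi> \<le> \<rho> * cos \<phi>" using \<open>\<rho> > 0\<close> by simp
    then show ?thesis using c_polar by linarith
  qed
  have "G a b \<ge> 0"
  proof (rule ccontr)
    assume neg: "\<not> G a b \<ge> 0"
    \<comment> \<open>the fourth angle, shifted by \<open>\<phi>\<close>, when the other three arguments equal \<open>\<theta> 1\<close>\<close>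
    define X where "X = 2 * pi - 3 * \<theta> 1 + \<phi>"
    \<comment> \<open>this keeps \<open>X\<close> below \<open>2 * pi\<close>, so that \<open>sin X\<close> cannot be positive once \<open>X\<close> exceeds \<open>pi\<close>\<close>
    have "\<theta> 1 > pi / 3"
    proof -
      have "(a\<^sup>2 + b\<^sup>2)\<^sup>2 + 2 * a * (a\<^sup>2 + b\<^sup>2) \<ge> 0" using \<open>a \<ge> 0\<close> by simp
      moreover have "G a b = (a\<^sup>2 + b\<^sup>2)\<^sup>2 + 2 * a * (a\<^sup>2 + b\<^sup>2) + 4 * a\<^sup>2 - (a\<^sup>2 + b\<^sup>2)"
        unfolding G_def by Groebner_Basis.algebra
      ultimately have "4 * a\<^sup>2 < a\<^sup>2 + b\<^sup>2" using neg by linarith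
      also have "a\<^sup>2 + b\<^sup>2 = (r 1)\<^sup>2"
        by (simp add: r_def m_def z complex_norm)
      finally have "(2 * a)\<^sup>2 < (r 1)\<^sup>2" by (simp add: power_mult_distrib)
      then have "2 * a < r 1" using r[of 1] by (auto intro: power2_less_imp_less)
      then have "cos (\<theta> 1) < cos (pi / 3)"
        unfolding z_polar(1) cos_60 using r[of 1] by simp
      then show ?thesis using \<theta>[of 1] cos_monotone_0_pi_le[of "\<theta> 1" "pi / 3"] by force
    qed
    have "sin (\<theta> 1 + \<phi>) ^ 3 * sin X \<le> sin \<phi> ^ 4"
    proof (cases "X \<le> pi")
      case True
      have X: "X = \<theta> t\<^sub>1 + \<phi> + (\<theta> t\<^sub>2 + \<phi>) + (\<theta> t\<^sub>3 + \<phi>) + (\<theta> t\<^sub>4 + \<phi>) - 3 * (\<theta> 1 + \<phi>)"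
        using \<Theta> by (simp add: X_def \<Theta>_def)
      show ?thesis
        using True mono[OF t(1)] mono[OF t(2)] mono[OF t(3)] mono[OF t(4)] \<theta>[of 1] \<phi>
        unfolding sines[symmetric] X by (intro prod_four_sin_ge_extreme) auto
    next
      case False
      then have "sin X \<le> 0"
        using \<open>\<theta> 1 > pi / 3\<close> \<phi> by (intro sin_le_zero) (auto simp: X_def)
      then have "sin (\<theta> 1 + \<phi>) ^ 3 * sin X \<le> 0"
        using sin_pos[of 1] by (simp add: mult_nonneg_nonpos)
      also have "0 \<le> sin \<phi> ^ 4" by simp
      finally show ?thesis .
    qed
    \<comment> \<open>the polar equation at \<open>z\<close> removes \<open>sin (\<theta> 1 + \<phi>)\<close>, and \<open>z ^ 3\<close> removes the multiple angles\<close>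
    then have "r 1 ^ 3 * (sin (\<theta> 1 + \<phi>) ^ 3 * sin X) \<le> r 1 ^ 3 * sin \<phi> ^ 4"
      using r[of 1] by simp
    also have "r 1 ^ 3 * (sin (\<theta> 1 + \<phi>) ^ 3 * sin X) = sin \<phi> ^ 3 * sin X"
      using line[of 1] by (metis mult.assoc power_mult_distrib)
    also have "r 1 ^ 3 * sin \<phi> ^ 4 = sin \<phi> ^ 3 * (r 1 ^ 3 * sin \<phi>)"
      by (simp add: eval_nat_numeral)
    finally have "sin X \<le> r 1 ^ 3 * sin \<phi>" using s\<phi> by simp
    then have "\<rho> * r 1 ^ 3 * sin X \<le> \<rho> * r 1 ^ 3 * (r 1 ^ 3 * sin \<phi>)"
      using \<open>\<rho> > 0\<close> r[of 1] by (intro mult_left_mono) auto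
    also have "\<dots> = b * ((r 1)\<^sup>2) ^ 3" unfolding c_polar(2) by Groebner_Basis.algebra
    also have "(r 1)\<^sup>2 = a\<^sup>2 + b\<^sup>2" by (simp add: r_def m_def z complex_norm)
    also have "\<rho> * r 1 ^ 3 * sin X = b * (a ^ 3 - 3 * a * b\<^sup>2) - (1 - a) * (3 * a\<^sup>2 * b - b ^ 3)"
    proof -
      have "m 1 ^ 3 = rcis (r 1 ^ 3) (3 * \<theta> 1)"
        using DeMoivre2[of "r 1" "\<theta> 1" 3] rcis[of 1] by simp
      moreover have "m 1 ^ 3 = Complex (a ^ 3 - 3 * a * b\<^sup>2) (3 * a\<^sup>2 * b - b ^ 3)"
        by (simp add: m_def z complex_eq_iff power3_eq_cube power2_eq_square algebra_simps)
      ultimately have cube: "a ^ 3 - 3 * a * b\<^sup>2 = r 1 ^ 3 * cos (3 * \<theta> 1)"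
        "3 * a\<^sup>2 * b - b ^ 3 = r 1 ^ 3 * sin (3 * \<theta> 1)"
        by (simp_all add: rcis_def complex_eq_iff)
      have "sin X = sin (2 * pi + (\<phi> - 3 * \<theta> 1))" by (simp add: X_def algebra_simps)
      also have "\<dots> = sin (\<phi> - 3 * \<theta> 1)" by (simp add: sin_add)
      finally have "sin X = sin \<phi> * cos (3 * \<theta> 1) - cos \<phi> * sin (3 * \<theta> 1)"
        by (simp add: sin_diff)
      then have "\<rho> * r 1 ^ 3 * sin X =
          (\<rho> * sin \<phi>) * (r 1 ^ 3 * cos (3 * \<theta> 1)) - (\<rho> * cos \<phi>) * (r 1 ^ 3 * sin (3 * \<theta> 1))"
        by (simp only: right_diff_distrib mult_ac)
      then show ?thesis by (simp only: c_polar[symmetric] cube[symmetric])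
    qed
    finally have "0 \<le> b * ((a\<^sup>2 + b\<^sup>2) ^ 3 - (a ^ 3 - 3 * a * b\<^sup>2) + (1 - a) * (3 * a\<^sup>2 - b\<^sup>2))"
      by (simp add: algebra_simps power2_eq_square power3_eq_cube)
    then have "0 \<le> b * (((1 - a)\<^sup>2 + b\<^sup>2) * G a b)" by (simp only: G_factor)
    moreover have "(1 - a)\<^sup>2 + b\<^sup>2 > 0" using b by (simp add: add_nonneg_pos)
    ultimately show False using b neg by (simp add: zero_le_mult_iff)
  qed
  show ?thesis
    using \<open>a \<ge> 0\<close> \<open>a < 1\<close> \<open>a + b \<le> 1\<close> \<open>G a b \<ge> 0\<close> by (simp add: a_def b_def)
qed

text \<open>
  The point \<open>1 / m ^ 3\<close> is on the line through \<open>1\<close> and \<open>m = x + i y\<close> with parameter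
  \<open>- Im (m ^ 3) / (y * n ^ 3) = (y\<^sup>2 - 3 * x\<^sup>2) / n ^ 3\<close>, as a look at the imaginary parts shows. On the
  curve \<open>G x y = 0\<close> the numerator equals \<open>n * (n + 2 * x)\<close>.
\<close>

lemma G_zero_cube_times_ray_point:
  assumes G0: "G x y = 0" and n: "n = x\<^sup>2 + y\<^sup>2" "n \<noteq> 0"
  shows "Complex x y ^ 3 * (1 + of_real ((n + 2 * x) / n\<^sup>2) * (Complex x y - 1)) = 1"
proof -
  have g: "n\<^sup>2 + 2 * x * n + 4 * x\<^sup>2 - n = 0" using G0 unfolding G_def n(1) by Groebner_Basis.algebra
  have Re: "(x ^ 3 - 3 * x * y\<^sup>2) * (n\<^sup>2 + (n + 2 * x) * (x - 1)) - (3 * x\<^sup>2 * y - y ^ 3) * ((n + 2 * x) * y) = n\<^sup>2"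
    using g n(1) by Groebner_Basis.algebra
  have Im: "(x ^ 3 - 3 * x * y\<^sup>2) * ((n + 2 * x) * y) + (3 * x\<^sup>2 * y - y ^ 3) * (n\<^sup>2 + (n + 2 * x) * (x - 1)) = 0"
    using g n(1) by Groebner_Basis.algebra
  have c: "Complex x y ^ 3 = Complex (x ^ 3 - 3 * x * y\<^sup>2) (3 * x\<^sup>2 * y - y ^ 3)"
    by (simp add: complex_eq_iff power3_eq_cube power2_eq_square algebra_simps)
  have "of_real (n\<^sup>2) * (Complex x y ^ 3 * (1 + of_real ((n + 2 * x) / n\<^sup>2) * (Complex x y - 1)))
      = Complex x y ^ 3 * (of_real (n\<^sup>2) + of_real (n + 2 * x) * (Complex x y - 1))"
    using n(2) by (simp add: field_simps)
  also have "\<dots> = of_real (n\<^sup>2)"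
    unfolding c using Re Im by (simp add: complex_eq_iff algebra_simps)
  finally show ?thesis using n(2) by simp
qed

lemma upper_half_plane_sufficient:
  assumes b: "b > 0" and a: "0 \<le> a" "a < 1" and ab: "a + b \<le> 1" and G: "G a b \<ge> 0"
  shows "Complex a b \<in> cycle4_spectral_region"
proof -
  define c where "c = 1 - a"
  have c: "0 < c" "c \<le> 1" "b \<le> c" using a ab by (simp_all add: c_def)
  \<comment> \<open>The ray starts in \<open>z\<close> at \<open>t = 1\<close> and meets the imaginary axis at \<open>t = 1 / c\<close>,
     at height \<open>b / c \<le> 1\<close>.\<close>
  have end1: "G (1 - 1 * c) (1 * b) \<ge> 0" using G by (simp add: c_def)
  have end2: "G (1 - 1 / c * c) (1 / c * b) \<le> 0"
  proof -
    have "(b / c)\<^sup>2 \<le> 1" using c b by (simp add: power_le_one)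
    then have "(b / c)\<^sup>2 * (b / c)\<^sup>2 \<le> (b / c)\<^sup>2 * 1" by (intro mult_left_mono) auto
    then show ?thesis using c by (simp add: G_def power2_eq_square)
  qed
  have "\<exists>t\<ge>1. t \<le> 1 / c \<and> G (1 - t * c) (t * b) = 0"
    using c by (intro IVT2'[where f = "\<lambda>t. G (1 - t * c) (t * b)", OF end2 end1]) (auto simp: G_def intro!: continuous_intros)
  then obtain t where t: "t \<ge> 1" "t \<le> 1 / c" and G0: "G (1 - t * c) (t * b) = 0" by blast
  define x y n where "x = 1 - t * c" and "y = t * b" and "n = x\<^sup>2 + y\<^sup>2"
  have "x \<ge> 0" using t c by (simp add: x_def field_simps)
  have "y > 0" using t b by (simp add: y_def)
  then have "n > 0" by (simp add: n_def add_nonneg_pos)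
  have "n\<^sup>2 + 2 * x * n + 4 * x\<^sup>2 - n = 0" using G0 unfolding n_def G_def x_def y_def by Groebner_Basis.algebra
  moreover have "2 * x * n \<ge> 0" using \<open>x \<ge> 0\<close> \<open>n > 0\<close> by simp
  moreover have "4 * x\<^sup>2 \<ge> 0" by simp
  ultimately have "n\<^sup>2 \<le> n + 2 * x" using \<open>x \<ge> 0\<close> by linarith
  \<comment> \<open>\<open>u\<close> is the parameter of \<open>1 / m ^ 3\<close> on the ray of \<open>m = x + i y\<close>, hence \<open>u * t\<close> on the ray of \<open>z\<close>\<close>
  define u where "u = (n + 2 * x) / n\<^sup>2"
  have "u \<ge> 1" using \<open>n\<^sup>2 \<le> n + 2 * x\<close> \<open>n > 0\<close> by (simp add: u_def)
  then have "u * t \<ge> 1" using t mult_mono[of 1 u 1 t] by simp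
  have xy: "Complex x y = 1 + of_real t * (Complex a b - 1)"
    by (simp add: x_def y_def c_def complex_eq_iff algebra_simps)
  have "Complex x y ^ 3 * (1 + of_real u * (Complex x y - 1)) = 1"
    unfolding u_def using G0 \<open>n > 0\<close>
    by (intro G_zero_cube_times_ray_point) (auto simp: n_def x_def y_def)
  moreover have "1 + of_real u * (Complex x y - 1) = 1 + of_real (u * t) * (Complex a b - 1)"
    unfolding xy by (simp add: mult.assoc)
  ultimately have "(1 + of_real t * (Complex a b - 1)) * (1 + of_real t * (Complex a b - 1)) *
      (1 + of_real t * (Complex a b - 1)) * (1 + of_real (u * t) * (Complex a b - 1)) = 1"
    unfolding xy by (simp only: power3_eq_cube)
  then show ?thesis
    unfolding cycle4_spectral_region_iff using t(1) \<open>u * t \<ge> 1\<close> by blast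
qed

section \<open>The real axis, conjugation and the whole region\<close>

lemma real_in_cycle4_spectral_region:
  assumes "-1 \<le> x" "x \<le> 1"
  shows "complex_of_real x \<in> cycle4_spectral_region"
proof (cases "x = 1")
  case True
  then show ?thesis unfolding cycle4_spectral_region_iff by auto
next
  case False
  \<comment> \<open>the parameter of the point \<open>-1\<close> on the ray\<close>
  define t where "t = 2 / (1 - x)"
  have "t \<ge> 1" using assms False by (simp add: t_def)
  have "1 + t * (x - 1) = - 1" using False by (simp add: t_def field_simps)
  then have "1 + complex_of_real t * (of_real x - 1) = - 1"
    by (metis of_real_1 of_real_add of_real_diff of_real_minus of_real_mult)
  then have "(1 + complex_of_real t * (of_real x - 1)) * (1 + of_real t * (of_real x - 1)) *
      (1 + of_real t * (of_real x - 1)) * (1 + of_real t * (of_real x - 1)) = 1"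
    by (simp only:) simp
  then show ?thesis unfolding cycle4_spectral_region_iff using \<open>t \<ge> 1\<close> by blast
qed

lemma cnj_in_cycle4_spectral_region:
  assumes "z \<in> cycle4_spectral_region"
  shows "cnj z \<in> cycle4_spectral_region"
proof -
  obtain t\<^sub>1 t\<^sub>2 t\<^sub>3 t\<^sub>4 where t: "t\<^sub>1 \<ge> 1" "t\<^sub>2 \<ge> 1" "t\<^sub>3 \<ge> 1" "t\<^sub>4 \<ge> 1"
    and prod: "(1 + of_real t\<^sub>1 * (z - 1)) * (1 + of_real t\<^sub>2 * (z - 1)) *
       (1 + of_real t\<^sub>3 * (z - 1)) * (1 + of_real t\<^sub>4 * (z - 1)) = 1"
    using assms unfolding cycle4_spectral_region_iff by blast
  have "(1 + of_real t\<^sub>1 * (cnj z - 1)) * (1 + of_real t\<^sub>2 * (cnj z - 1)) *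
       (1 + of_real t\<^sub>3 * (cnj z - 1)) * (1 + of_real t\<^sub>4 * (cnj z - 1)) = 1"
    using arg_cong[OF prod, of cnj] by simp
  then show ?thesis
    unfolding cycle4_spectral_region_iff using t by blast
qed

lemma upper_half_plane_iff:
  assumes "b > 0"
  shows "Complex a b \<in> cycle4_spectral_region \<longleftrightarrow> 0 \<le> a \<and> a < 1 \<and> a + b \<le> 1 \<and> G a b \<ge> 0"
proof
  assume "Complex a b \<in> cycle4_spectral_region"
  then show "0 \<le> a \<and> a < 1 \<and> a + b \<le> 1 \<and> G a b \<ge> 0"
    unfolding cycle4_spectral_region_iff
    using upper_half_plane_necessary[of "Complex a b"] assms by auto
qed (use upper_half_plane_sufficient assms in auto)

lemma real_axis_iff:
  "complex_of_real x \<in> cycle4_spectral_region \<longleftrightarrow> x \<in> {-1..1}"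
proof
  assume "complex_of_real x \<in> cycle4_spectral_region"
  then have "norm (complex_of_real x) \<le> 1"
    unfolding cycle4_spectral_region_iff using norm_le_1_of_prod_eq_1 by blast
  then show "x \<in> {-1..1}" by auto
qed (use real_in_cycle4_spectral_region in auto)

theorem theorem3p2:
  shows "cycle4_spectral_region =
    {Complex a b | a b :: real. 0 \<le> a \<and> a < 1 \<and> a + \<bar>b\<bar> \<le> 1 \<and> G a b \<ge> 0}
    \<union> complex_of_real ` {-1..1}"
proof -
  have nonreal: "Complex a b \<in> cycle4_spectral_region \<longleftrightarrow>
      0 \<le> a \<and> a < 1 \<and> a + \<bar>b\<bar> \<le> 1 \<and> G a b \<ge> 0" if "b \<noteq> 0" for a b
  proof -
    have "Complex a b \<in> cycle4_spectral_region \<longleftrightarrow> Complex a \<bar>b\<bar> \<in> cycle4_spectral_region"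
      using cnj_in_cycle4_spectral_region[of "Complex a b"]
        cnj_in_cycle4_spectral_region[of "Complex a (- b)"]
      by (auto simp: abs_if complex_cnj)
    also have "\<dots> \<longleftrightarrow> 0 \<le> a \<and> a < 1 \<and> a + \<bar>b\<bar> \<le> 1 \<and> G a \<bar>b\<bar> \<ge> 0"
      using that by (intro upper_half_plane_iff) simp
    also have "G a \<bar>b\<bar> = G a b" by (simp add: G_def)
    finally show ?thesis .
  qed
  have real: "Complex a 0 \<in> cycle4_spectral_region \<longleftrightarrow> a \<in> {-1..1}" for a
    using real_axis_iff[of a] by (simp add: complex_of_real_def)
  show ?thesis
    (is "_ = ?S \<union> ?T")
  proof (rule Set.set_eqI)
    fix z
    obtain a b where z: "z = Complex a b" by (cases z)
    show "z \<in> cycle4_spectral_region \<longleftrightarrow> z \<in> ?S \<union> ?T"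
    proof (cases "b = 0")
      case True
      have "z \<in> ?T \<longleftrightarrow> a \<in> {-1..1}" by (auto simp: z True complex_of_real_def)
      moreover have "a \<in> {-1..1}" if "z \<in> ?S" using that by (auto simp: z)
      ultimately show ?thesis using real[of a] by (auto simp: z True)
    next
      case False
      then have "z \<notin> ?T" by (auto simp: z complex_of_real_def)
      then show ?thesis using nonreal[OF False, of a] by (auto simp: z)
    qed
  qed
qed

end
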